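(* Let $m\ge0$ be an integer, $p\in\mathbb{R}$, and $c_n(p)=b_n-pW_n$ for $n\ge0$. If $p\le \pi(\pi+9)e^{\pi/2}/48$, then the double inequality $$2e^{\mathcal{K}\left(\sqrt{\frac{x+y}{2}}\right)}+p\left(\frac{1}{\sqrt{1-x}}+\frac{1}{\sqrt{1-y}}-\frac{2}{\sqrt{1-\frac{x+y}{2}}}\right)+\sum_{n=0}^{m}c_n(p)\left[x^n+y^n-2\left(\frac{x+y}{2}\right)^n\right]$$ $$<e^{\mathcal{K}(\sqrt{x})}+e^{\mathcal{K}(\sqrt{y})}$$ $$<e^{\mathcal{K}(\sqrt{x+y})}+p\left(\frac{1}{\sqrt{1-x}}+\frac{1}{\sqrt{1-y}}-\frac{1}{\sqrt{1-x-y}}\right)+\sum_{n=0}^{m}c_n(p)\left[x^n+y^n-(x+y)^n\right]$$ holds for $x,y,x+y\in(0,1)$, and it reverses if $p\ge4$.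
   Context: $\mathcal{K}(r)=\int_0^{\pi/2}\frac{dt}{\sqrt{1-r^2\sin^2 t}}$ for $r\in(0,1)$ is the complete elliptic integral of the first kind. For $n\ge0$, $W_n=\frac{(2n-1)!!}{(2n)!!}=\frac{\Gamma(n+1/2)}{\Gamma(1/2)\Gamma(n+1)}$ (so $W_0=1$); the $W_n$ are the coefficients in $1/\sqrt{1-x}=\sum_{n=0}^\infty W_nx^n$. The numbers $b_n$ ($n\ge0$) are the coefficients in the power series $e^{\mathcal{K}(\sqrt{x})}=\sum_{n=0}^\infty b_nx^n$ on $(0,1)$ (in particular $b_0=e^{\pi/2}$).
   Formalization: For x = y both sides of the first inequality coincide, so it cannot be strict there; the first inequality (and its reversal for p ≥ 4) is proved as non-strict in general and strict for x ≠ y, while the second is strict throughout. *)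

theory Defs
  imports "HOL-Analysis.Analysis"
begin

definition ellK :: "real \<Rightarrow> real" where
  "ellK r = integral {0..pi/2} (\<lambda>t. 1 / sqrt (1 - r\<^sup>2 * (sin t)\<^sup>2))"

(* W_coeff n = (2n-1)!! / (2n)!! *)
definition W_coeff :: "nat \<Rightarrow> real" where
  "W_coeff n = (\<Prod>k=1..n. 2 * real k - 1) / (\<Prod>k=1..n. 2 * real k)"

lemma W_coeff_Gamma: "W_coeff n = Gamma (real n + 1/2) / (Gamma (1/2) * Gamma (real n + 1))"
proof (induction n)
  case 0
  have "Gamma (1/2 :: real) \<noteq> 0"
    by (simp add: Gamma_one_half_real)
  then show ?case
    by (simp add: W_coeff_def)
next
  case (Suc n)
  have 1: "Gamma (real (Suc n) + 1/2) = (real n + 1/2) * Gamma (real n + 1/2)"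
    using Gamma_plus1[of "real n + 1/2"] nonpos_Ints_nonpos[of "real n + 1/2"]
    by (force simp: add_ac)
  have 2: "Gamma (real (Suc n) + 1) = (real n + 1) * Gamma (real n + 1)"
    using Gamma_plus1[of "real n + 1"] nonpos_Ints_nonpos[of "real n + 1"]
    by (force simp: add_ac)
  have "W_coeff (Suc n) = W_coeff n * ((2 * real n + 1) / (2 * (real n + 1)))"
    by (simp add: W_coeff_def algebra_simps)
  also have "\<dots> = W_coeff n * ((real n + 1/2) / (real n + 1))"
    by (simp add: field_simps)
  also have "\<dots> = Gamma (real (Suc n) + 1/2) / (Gamma (1/2) * Gamma (real (Suc n) + 1))"
    unfolding Suc.IH 1 2 by (simp add: mult_ac)
  finally show ?case .
qed

(* The power series coefficients of exp (K (sqrt x)) on (0,1). They exist and are unique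
   because K (sqrt x) is itself a power series in x on (0,1). *)
definition b_coeff :: "nat \<Rightarrow> real" where
  "b_coeff = (THE a. \<forall>x\<in>{0<..<1}. (\<lambda>n. a n * x ^ n) sums exp (ellK (sqrt x)))"

definition c_coeff :: "real \<Rightarrow> nat \<Rightarrow> real" where
  "c_coeff p n = b_coeff n - p * W_coeff n"

definition lower_bd :: "nat \<Rightarrow> real \<Rightarrow> real \<Rightarrow> real \<Rightarrow> real" where
  "lower_bd m p x y =
     2 * exp (ellK (sqrt ((x + y) / 2)))
     + p * (1 / sqrt (1 - x) + 1 / sqrt (1 - y) - 2 / sqrt (1 - (x + y) / 2))
     + (\<Sum>n=0..m. c_coeff p n * (x ^ n + y ^ n - 2 * ((x + y) / 2) ^ n))"

definition upper_bd :: "nat \<Rightarrow> real \<Rightarrow> real \<Rightarrow> real \<Rightarrow> real" where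
  "upper_bd m p x y =
     exp (ellK (sqrt (x + y)))
     + p * (1 / sqrt (1 - x) + 1 / sqrt (1 - y) - 1 / sqrt (1 - x - y))
     + (\<Sum>n=0..m. c_coeff p n * (x ^ n + y ^ n - (x + y) ^ n))"

end

theory Submission
  imports Defs "HOL-Real_Asymp.Real_Asymp"
begin

text \<open>
  Put \<open>B n = b_coeff n / exp (pi/2)\<close>, called \<open>exp_coeff n\<close> below, and \<open>W n = W_coeff n\<close>. Subtracting
  \<open>p\<close> times the series of \<open>1 / sqrt (1 - x)\<close> from that of \<open>exp (ellK (sqrt x))\<close> leaves the series with
  coefficients \<open>c_coeff p n\<close>. Hence the difference between the middle term and either bound is
  the tail, over \<open>n > m\<close>, of a series whose terms are \<open>c_coeff p n\<close> times
  \<open>x^n + y^n - 2 ((x+y)/2)^n\<close> or \<open>x^n + y^n - (x+y)^n\<close>. For \<open>n = 1\<close> these factors vanish; for \<open>n \<ge> 2\<close>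
  they are nonnegative (positive if \<open>x \<noteq> y\<close>) and negative, respectively. So everything rests on the signs of
  \<open>c_coeff p n\<close> for \<open>n \<ge> 2\<close>, that is on locating \<open>b_coeff n / W n\<close>. The constant
  \<open>pi (pi + 9) exp (pi/2) / 48\<close> is its value at \<open>n = 2\<close> and \<open>4\<close> is its limit, so it is enough
  that the ratio increases strictly from \<open>n = 1\<close> on.

  For the monotonicity (\<open>exp_coeff_ratio_increasing\<close>) write \<open>K x\<close> for \<open>ellK (sqrt x)\<close>. It has the coefficients
  \<open>k n = (pi/2) (W n)^2\<close>, and \<open>n * k n\<close> increases to \<open>1/2\<close>, with increments \<open>d n = k n / (4 (n+1))\<close>.
  With \<open>f = \<Sum> B n x^n\<close>, comparing coefficients in \<open>(1 - x) f' = ((1 - x) K') f\<close> gives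
  \<open>(n+1) B (n+1) = n B n + S n\<close> where \<open>S n = \<Sum>k\<le>n. d k B (n-k)\<close>, while
  \<open>(n+1) W (n+1) = (n + 1/2) W n\<close>. The ratio increases at \<open>n\<close> exactly if \<open>S n > B n / 2\<close>. Since the \<open>d k\<close>
  sum to \<open>1/2\<close>, this asks that the decrease of \<open>B\<close> outweighs the missing tail \<open>\<Sum>k>n. d k\<close>,
  which is at most \<open>1 / (8 (n+1))\<close>.
  The argument bootstraps. As \<open>n B n\<close> increases, \<open>B\<close> decreases at most
  like \<open>1/n\<close>, which gives the crude upper bound \<open>S n \<le> 0.58 B n\<close>. Fed back into the recurrence, that
  bound makes \<open>B\<close> decrease at least like \<open>n^(-0.42)\<close>, and then the gain
  \<open>0.42/n * \<Sum>k\<le>n. k d k\<close> exceeds the loss \<open>1 / (8 (n+1))\<close>, because the sum diverges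
  logarithmically and is already at least \<open>0.3\<close> for \<open>n \<ge> 20\<close>. For \<open>1 \<le> n < 20\<close> both inequalities on \<open>S n\<close> are
  checked by interval arithmetic on integers (\<open>step_conv_window_small\<close>).

  For the limit (\<open>exp_coeff_ratio_less\<close>), bounding the integrand of \<open>K\<close> by an elementary derivative shows
  that \<open>sqrt (1 - x) * exp (K x)\<close> has limit superior at most \<open>4\<close> as \<open>x\<close> tends to 1. A ratio
  of at least \<open>4\<close> at some \<open>n\<close> would, by strict monotonicity, force all later ratios above some
  \<open>\<rho> > 4\<close> and contradict this.
\<close>

section \<open>The Wallis numbers\<close>

lemma W_coeff_0 [simp]: "W_coeff 0 = 1"
  by (simp add: W_coeff_def)

lemma W_coeff_Suc: "W_coeff (Suc n) = W_coeff n * (2 * real n + 1) / (2 * real n + 2)"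
  by (simp add: W_coeff_def algebra_simps)

lemma W_coeff_pos [simp]: "W_coeff n > 0"
  by (induction n) (auto simp: W_coeff_Suc)

lemma W_coeff_le_1: "W_coeff n \<le> 1"
proof (induction n)
  case (Suc n)
  have "W_coeff n * ((2 * real n + 1) / (2 * real n + 2)) \<le> 1 * 1"
    using Suc by (intro mult_mono) (auto simp: less_imp_le)
  then show ?case by (simp add: W_coeff_Suc)
qed simp

text \<open>
  The partial products of Wallis' formula telescope to \<open>1 / ((W n)^2 (2 n + 1))\<close>.
\<close>
lemma W_coeff_wallis_limit: "(\<lambda>n. real n * (W_coeff n)\<^sup>2) \<longlonglongrightarrow> 1 / pi"
proof -
  have eq: "(\<Prod>k=1..n. (4 * real k ^ 2) / (4 * real k ^ 2 - 1)) * ((W_coeff n)\<^sup>2 * (2 * real n + 1)) = 1"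
    for n
  proof (induction n)
    case (Suc n)
    have "4 * (real n + 1)\<^sup>2 - 1 = (2 * real n + 1) * (2 * real n + 3)"
      by (simp add: power2_eq_square algebra_simps)
    then have step: "4 * real (Suc n) ^ 2 / (4 * real (Suc n) ^ 2 - 1) * ((W_coeff (Suc n))\<^sup>2 * (2 * real (Suc n) + 1))
        = (W_coeff n)\<^sup>2 * (2 * real n + 1)"
      by (simp add: W_coeff_Suc power_divide power_mult_distrib divide_simps add_ac)
         (simp add: power2_eq_square algebra_simps)
    have "(\<Prod>k=1..Suc n. (4 * real k ^ 2) / (4 * real k ^ 2 - 1)) * ((W_coeff (Suc n))\<^sup>2 * (2 * real (Suc n) + 1))
        = (\<Prod>k=1..n. (4 * real k ^ 2) / (4 * real k ^ 2 - 1)) *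
          (4 * real (Suc n) ^ 2 / (4 * real (Suc n) ^ 2 - 1) * ((W_coeff (Suc n))\<^sup>2 * (2 * real (Suc n) + 1)))"
      by (subst prod.cl_ivl_Suc) (simp del: of_nat_Suc)
    then show ?case using Suc.IH by (simp only: step)
  qed simp
  have "(\<lambda>n. inverse (\<Prod>k=1..n. (4 * real k ^ 2) / (4 * real k ^ 2 - 1))) \<longlonglongrightarrow> inverse (pi / 2)"
    by (intro tendsto_inverse wallis) simp
  then have "(\<lambda>n. (W_coeff n)\<^sup>2 * (2 * real n + 1)) \<longlonglongrightarrow> inverse (pi / 2)"
    by (simp only: inverse_unique[OF eq])
  then have *: "(\<lambda>n. (W_coeff n)\<^sup>2 * (2 * real n + 1)) \<longlonglongrightarrow> 2 / pi"
    by simp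
  have "(\<lambda>n. real n / (2 * real n + 1)) \<longlonglongrightarrow> 1 / 2"
    by real_asymp
  from tendsto_mult[OF * this]
  have "(\<lambda>n. (W_coeff n)\<^sup>2 * (2 * real n + 1) * (real n / (2 * real n + 1))) \<longlonglongrightarrow> 1 / pi"
    by simp
  moreover have "(W_coeff n)\<^sup>2 * (2 * real n + 1) * (real n / (2 * real n + 1)) = real n * (W_coeff n)\<^sup>2" for n
    by (simp add: add_pos_nonneg less_imp_neq[symmetric])
  ultimately show ?thesis by (simp only:)
qed

text \<open>
  The left-hand side increases with \<open>n\<close> and tends to 1. This estimate and the companion lower
  bound below differ by a relative error of order \<open>1/n^2\<close> only; they control the coefficients
  of \<open>K\<close> and, read backwards at a single \<open>n\<close>, also yield numerical bounds for \<open>pi\<close>.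
\<close>
lemma W_coeff_sq_upper: "pi * (W_coeff n)\<^sup>2 * (real n + 1/4) \<le> 1"
proof -
  have "incseq (\<lambda>n. (W_coeff n)\<^sup>2 * (real n + 1/4))"
  proof (rule incseq_SucI)
    fix n
    have "(W_coeff (Suc n))\<^sup>2 * (real (Suc n) + 1/4) - (W_coeff n)\<^sup>2 * (real n + 1/4)
        = (W_coeff n)\<^sup>2 * (1 / (4 * (2 * real n + 2)\<^sup>2))"
      by (simp add: W_coeff_Suc power_divide power_mult_distrib divide_simps)
         (simp add: power2_eq_square algebra_simps)
    also have "\<dots> \<ge> 0" by simp
    finally show "(W_coeff n)\<^sup>2 * (real n + 1/4) \<le> (W_coeff (Suc n))\<^sup>2 * (real (Suc n) + 1/4)"
      by linarith
  qed
  moreover have "(\<lambda>n. (W_coeff n)\<^sup>2 * (real n + 1/4)) \<longlonglongrightarrow> 1 / pi"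
  proof -
    have "(\<lambda>n. (real n + 1/4) / real n) \<longlonglongrightarrow> 1" by real_asymp
    from tendsto_mult[OF W_coeff_wallis_limit this]
    have "(\<lambda>n. real n * (W_coeff n)\<^sup>2 * ((real n + 1/4) / real n)) \<longlonglongrightarrow> 1 / pi"
      by simp
    then show ?thesis
      by (rule Lim_transform_eventually) (auto simp: field_simps eventually_sequentially intro!: exI[of _ 1])
  qed
  ultimately have "(W_coeff n)\<^sup>2 * (real n + 1/4) \<le> 1 / pi"
    by (rule incseq_le)
  then show ?thesis by (simp add: field_simps)
qed

text \<open>
  The quotient of the two sides decreases with \<open>n\<close> and tends to 1.
\<close>
lemma W_coeff_sq_lower:
  assumes "n \<ge> 1"
  shows "pi * (W_coeff n)\<^sup>2 * (real n)\<^sup>2 \<ge> real n - 1/4"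
proof -
  define g where "g = (\<lambda>n. (W_coeff (Suc n))\<^sup>2 * (real (Suc n))\<^sup>2 / (real (Suc n) - 1/4))"
  have "decseq g"
  proof (rule decseq_SucI)
    fix n
    define m where "m = real n + 1"
    have m: "m > 0" "m - 1/4 > 0" "m + 1 - 1/4 > 0" by (auto simp: m_def)
    have W: "(W_coeff (Suc (Suc n)))\<^sup>2 * (m + 1)\<^sup>2 = (W_coeff (Suc n))\<^sup>2 * (m + 1/2)\<^sup>2"
      using m by (subst W_coeff_Suc)
        (simp add: m_def power_divide power_mult_distrib divide_simps,
          simp add: power2_eq_square algebra_simps)
    have "(m + 1/2)\<^sup>2 / (m + 1 - 1/4) \<le> m\<^sup>2 / (m - 1/4)"
      using m by (simp add: divide_simps) (simp add: power2_eq_square algebra_simps)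
    then have "(W_coeff (Suc n))\<^sup>2 * ((m + 1/2)\<^sup>2 / (m + 1 - 1/4)) \<le> (W_coeff (Suc n))\<^sup>2 * (m\<^sup>2 / (m - 1/4))"
      by (intro mult_left_mono) auto
    then show "g (Suc n) \<le> g n"
      using W by (simp add: g_def m_def add_ac)
  qed
  moreover have "g \<longlonglongrightarrow> 1 / pi"
  proof -
    have "(\<lambda>n. real (Suc n) / (real (Suc n) - 1/4)) \<longlonglongrightarrow> 1" by real_asymp
    from tendsto_mult[OF LIMSEQ_Suc[OF W_coeff_wallis_limit] this] show ?thesis
      by (simp add: g_def power2_eq_square mult_ac)
  qed
  ultimately have "1 / pi \<le> g (n - 1)" by (rule decseq_ge)
  with assms show ?thesis by (simp add: g_def field_simps)
qed

lemma pi_bounds: "3.14 < pi" "pi < 3.143"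
proof -
  \<comment> \<open>at index 10 the two estimates already place \<open>pi\<close> between 3.1405 and 3.1426\<close>
  have W: "W_coeff 10 = 46189 / 262144"
    by (simp add: W_coeff_Suc numeral_eq_Suc)
  show "3.14 < pi" using W_coeff_sq_lower[of 10] by (simp add: W power2_eq_square)
  show "pi < 3.143" using W_coeff_sq_upper[of 10] by (simp add: W power2_eq_square)
qed


section \<open>The power series of the elliptic integral\<close>

definition ell_coeff :: "nat \<Rightarrow> real" where
  "ell_coeff n = pi / 2 * (W_coeff n)\<^sup>2"

text \<open>
  These are the coefficients of \<open>(1 - x) K'\<close>, where \<open>K\<close> stands for \<open>ellK (sqrt x)\<close> as a function of \<open>x\<close>: the closed form
  below is the difference of consecutive values of \<open>n * ell_coeff n\<close>, by \<open>ell_step_eq\<close>.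
\<close>
definition ell_step :: "nat \<Rightarrow> real" where
  "ell_step n = ell_coeff n / (4 * (real n + 1))"

lemma ell_coeff_pos [simp]: "ell_coeff n > 0"
  by (simp add: ell_coeff_def less_imp_neq[OF W_coeff_pos, symmetric])

lemma ell_step_pos [simp]: "ell_step n > 0"
  by (simp add: ell_step_def)

lemma ell_step_eq: "ell_step n = real (Suc n) * ell_coeff (Suc n) - real n * ell_coeff n"
  by (simp add: ell_step_def ell_coeff_def W_coeff_Suc power_divide power_mult_distrib divide_simps)
     (simp add: power2_eq_square algebra_simps)

lemma ell_step_0: "ell_step 0 = pi / 8"
  by (simp add: ell_step_def ell_coeff_def)

lemma ell_step_Suc:
  "ell_step (Suc n) = ell_step n * (2 * real n + 1)\<^sup>2 / (4 * (real n + 1) * (real n + 2))"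
  by (simp add: ell_step_def ell_coeff_def W_coeff_Suc power_divide power_mult_distrib divide_simps)
     (simp add: power2_eq_square algebra_simps)

lemma sum_ell_step: "(\<Sum>k<n. ell_step k) = real n * ell_coeff n"
  by (induction n) (auto simp: ell_step_eq)

lemma weighted_ell_coeff_le: "real n * ell_coeff n \<le> 1/2"
proof -
  have "real n * ell_coeff n \<le> (pi * (W_coeff n)\<^sup>2 * (real n + 1/4)) / 2"
    by (simp add: ell_coeff_def field_simps)
  then show ?thesis using W_coeff_sq_upper[of n] by simp
qed

text \<open>
  The constant \<open>1/8\<close> is sharp, and the lower bound for \<open>step_conv\<close> at large indices
  needs it: it measures the part of the total mass \<open>1/2\<close> that \<open>ell_step\<close> still lacks after \<open>n\<close> terms.
\<close>
lemma weighted_ell_coeff_ge: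
  assumes "n \<ge> 1"
  shows "real n * ell_coeff n \<ge> 1/2 - 1 / (8 * real n)"
proof -
  have "real n * ell_coeff n = pi * (W_coeff n)\<^sup>2 * (real n)\<^sup>2 / (2 * real n)"
    using assms by (simp add: ell_coeff_def power2_eq_square)
  also have "\<dots> \<ge> (real n - 1/4) / (2 * real n)"
    by (intro divide_right_mono W_coeff_sq_lower assms) simp
  also have "(real n - 1/4) / (2 * real n) = 1/2 - 1 / (8 * real n)"
    using assms by (simp add: field_simps)
  finally show ?thesis .
qed


lemma gbinomial_minus_half: "(-1/2 gchoose n) * (-1) ^ n = W_coeff n"
proof (induction n)
  case (Suc n)
  have "(-1/2 gchoose Suc n) = (-1/2 - real n) / (real n + 1) * (-1/2 gchoose n)"
    using gbinomial_mult_1[of "-1/2 :: real" n] by (simp add: field_simps)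
  then have "(-1/2 gchoose Suc n) * (-1) ^ Suc n
      = (-1/2 - real n) / (real n + 1) * (-1/2 gchoose n) * (- ((-1) ^ n))"
    by (simp only: power_Suc mult_minus1)
  also have "\<dots> = (2 * real n + 1) / (2 * real n + 2) * ((-1/2 gchoose n) * (-1) ^ n)"
    by (simp add: field_simps)
  finally have "(-1/2 gchoose Suc n) * (-1) ^ Suc n
      = (2 * real n + 1) / (2 * real n + 2) * ((-1/2 gchoose n) * (-1) ^ n)" .
  then show ?case by (simp only: Suc W_coeff_Suc) simp
qed simp

lemma W_coeff_sums:
  assumes z: "\<bar>z\<bar> < 1"
  shows "(\<lambda>n. W_coeff n * z ^ n) sums (1 / sqrt (1 - z))"
proof -
  have "(\<lambda>n. (-1/2 gchoose n) * (-z) ^ n) sums (1 + - z) powr (-1/2)"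
    using z by (intro gen_binomial_real) simp
  moreover have "(1 + - z) powr (-1/2) = 1 / sqrt (1 - z)"
  proof -
    have "(1 + - z) powr (-1/2) = (1 - z) powr (- (1/2))"
      by (simp only: add_uminus_conv_diff minus_divide_left)
    also have "\<dots> = inverse ((1 - z) powr (1/2))"
      by (rule powr_minus)
    also have "(1 - z) powr (1/2) = sqrt (1 - z)"
      by (rule powr_half_sqrt) (use z in simp)
    finally show ?thesis by (simp only: inverse_eq_divide)
  qed
  moreover have "(-1/2 gchoose n) * (-z) ^ n = W_coeff n * z ^ n" for n
  proof -
    have "(- z) ^ n = (-1) ^ n * z ^ n" by (rule power_minus)
    then have "(-1/2 gchoose n) * (-z) ^ n = (-1/2 gchoose n) * (-1) ^ n * z ^ n"
      by (simp only: mult.assoc)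
    then show ?thesis by (simp only: gbinomial_minus_half)
  qed
  ultimately show ?thesis by (simp only:)
qed

text \<open>
  The function \<open>sin t ^ (2 n + 1) * cos t\<close> vanishes at both ends, so its derivative integrates to 0;
  this is the reduction formula from \<open>n + 1\<close> to \<open>n\<close>.
\<close>
lemma sin_even_power_has_integral:
  "((\<lambda>t. sin t ^ (2 * n)) has_integral (pi / 2 * W_coeff n)) {0..pi/2}"
proof (induction n)
  case 0
  show ?case using has_integral_const_real[of "1::real" 0 "pi/2"] by simp
next
  case (Suc n)
  have "((\<lambda>t. (2 * real n + 1) * sin t ^ (2 * n) - (2 * real n + 2) * sin t ^ (2 * Suc n)) has_integral
       (sin (pi/2) ^ (2 * n + 1) * cos (pi/2) - sin 0 ^ (2 * n + 1) * cos 0)) {0..pi/2}"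
  proof (rule fundamental_theorem_of_calculus)
    fix t :: real
    have "((\<lambda>t. sin t ^ Suc (2 * n) * cos t) has_real_derivative
        (real (Suc (2 * n)) * sin t ^ (2 * n) * cos t) * cos t - sin t ^ Suc (2 * n) * sin t) (at t within {0..pi/2})"
      by (auto intro!: derivative_eq_intros simp del: power_Suc of_nat_Suc)
    also have "(real (Suc (2 * n)) * sin t ^ (2 * n) * cos t) * cos t - sin t ^ Suc (2 * n) * sin t
        = (2 * real n + 1) * sin t ^ (2 * n) * (cos t)\<^sup>2 - sin t ^ (2 * Suc n)"
      by (simp add: power2_eq_square algebra_simps)
    also have "\<dots> = (2 * real n + 1) * sin t ^ (2 * n) - (2 * real n + 2) * sin t ^ (2 * Suc n)"
      unfolding cos_squared_eq by (simp add: power2_eq_square algebra_simps)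
    finally show "((\<lambda>t. sin t ^ (2 * n + 1) * cos t) has_vector_derivative
        (2 * real n + 1) * sin t ^ (2 * n) - (2 * real n + 2) * sin t ^ (2 * Suc n)) (at t within {0..pi/2})"
      by (simp add: has_real_derivative_iff_has_vector_derivative)
  qed simp
  then have "((\<lambda>t. (2 * real n + 1) * sin t ^ (2 * n) - (2 * real n + 2) * sin t ^ (2 * Suc n)) has_integral 0) {0..pi/2}"
    by simp
  from has_integral_diff[OF has_integral_mult_right[OF Suc, of "2 * real n + 1"] this]
  have "((\<lambda>t. (2 * real n + 2) * sin t ^ (2 * Suc n)) has_integral ((2 * real n + 1) * (pi / 2 * W_coeff n))) {0..pi/2}"
    by simp
  from has_integral_mult_right[OF this, of "1 / (2 * real n + 2)"]
  show ?case by (simp add: W_coeff_Suc mult_ac)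
qed

text \<open>
  Expand the integrand in powers of \<open>x (sin t)^2\<close>. The convergence is uniform in \<open>t\<close>, dominated by
  the geometric series in \<open>x\<close>, so integration is termwise; each term contributes one factor \<open>W n\<close>
  from the binomial series and one from the integral.
\<close>
lemma ellK_sums:
  assumes "0 \<le> x" "x < 1"
  shows "(\<lambda>n. ell_coeff n * x ^ n) sums ellK (sqrt x)"
proof -
  define f where "f = (\<lambda>n t. W_coeff n * (x * (sin t)\<^sup>2) ^ n)"
  have small: "0 \<le> x * (sin t)\<^sup>2" "x * (sin t)\<^sup>2 \<le> x" for t
    using assms by (auto simp: mult_left_le abs_square_le_1)
  have sum_f: "(\<lambda>n. f n t) sums (1 / sqrt (1 - x * (sin t)\<^sup>2))" for t
    unfolding f_def using small[of t] assms by (intro W_coeff_sums) auto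
  have "uniform_limit {0..pi/2} (\<lambda>N t. \<Sum>n<N. f n t) (\<lambda>t. \<Sum>n. f n t) sequentially"
  proof (rule Weierstrass_m_test)
    fix n t
    have "W_coeff n * (x * (sin t)\<^sup>2) ^ n \<le> 1 * x ^ n"
      using small[of t] by (intro mult_mono power_mono W_coeff_le_1) auto
    then show "norm (f n t) \<le> x ^ n"
      using small[of t] by (simp add: f_def abs_mult less_imp_le)
  qed (use assms in \<open>auto intro: summable_geometric\<close>)
  then obtain I J where I: "\<And>N. ((\<lambda>t. \<Sum>n<N. f n t) has_integral I N) {0..pi/2}"
    and J: "((\<lambda>t. \<Sum>n. f n t) has_integral J) {0..pi/2}" and lim: "I \<longlonglongrightarrow> J"
    by (rule uniform_limit_integral) (auto simp: f_def intro!: continuous_intros)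
  have "J = ellK (sqrt x)"
    using J sums_unique[OF sum_f] assms by (simp add: ellK_def integral_unique)
  moreover have "I N = (\<Sum>n<N. ell_coeff n * x ^ n)" for N
  proof (rule has_integral_unique[OF I])
    have "((\<lambda>t. f n t) has_integral (ell_coeff n * x ^ n)) {0..pi/2}" for n
      using has_integral_mult_right[OF sin_even_power_has_integral[of n], of "W_coeff n * x ^ n"]
      by (simp add: f_def ell_coeff_def power_mult_distrib power_mult power2_eq_square mult_ac)
    then show "((\<lambda>t. \<Sum>n<N. f n t) has_integral (\<Sum>n<N. ell_coeff n * x ^ n)) {0..pi/2}"
      by (intro has_integral_sum) auto
  qed
  then have "I = (\<lambda>N. \<Sum>n<N. ell_coeff n * x ^ n)" by (rule ext)
  ultimately show ?thesis using lim unfolding sums_def by simp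
qed


section \<open>The power series of the exponential\<close>

text \<open>
  The recursion compares coefficients in \<open>f' = K' f\<close> for \<open>f = exp (K - pi/2)\<close>. Normalising \<open>f\<close> to value 1 at
  0 removes \<open>exp (pi/2)\<close> from all numerical estimates.
\<close>
fun exp_coeff :: "nat \<Rightarrow> real" where
  "exp_coeff 0 = 1"
| "exp_coeff (Suc n) = (\<Sum>k\<le>n. real (Suc k) * ell_coeff (Suc k) * exp_coeff (n - k)) / real (Suc n)"

declare exp_coeff.simps(2) [simp del]

lemma exp_coeff_pos [simp]: "exp_coeff n > 0"
proof (induction n rule: exp_coeff.induct)
  case (2 n)
  then show ?case
    by (auto simp: exp_coeff.simps(2) intro!: divide_pos_pos sum_pos mult_pos_pos)
qed simp


lemma exp_coeff_le_1: "exp_coeff n \<le> 1"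
proof (induction n rule: less_induct)
  case (less n)
  show ?case
  proof (cases n)
    case (Suc m)
    have "(\<Sum>k\<le>m. real (Suc k) * ell_coeff (Suc k) * exp_coeff (m - k)) \<le> (\<Sum>k\<le>m. 1/2 * 1)"
      using less Suc by (intro sum_mono mult_mono weighted_ell_coeff_le) (auto simp: less_imp_le)
    also have "\<dots> \<le> real (Suc m)" by simp
    finally show ?thesis by (simp add: Suc exp_coeff.simps(2))
  qed simp
qed

lemma summable_bounded_powser:
  fixes c :: "nat \<Rightarrow> real"
  assumes "\<And>n. \<bar>c n\<bar> \<le> C" "\<bar>x\<bar> < 1"
  shows "summable (\<lambda>n. norm (c n * x ^ n))"
proof (rule summable_comparison_test)
  show "\<exists>N. \<forall>n\<ge>N. norm (norm (c n * x ^ n)) \<le> C * \<bar>x\<bar> ^ n"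
    using assms(1) by (auto simp: abs_mult power_abs intro!: mult_right_mono)
  show "summable (\<lambda>n. C * \<bar>x\<bar> ^ n)"
    using assms(2) by (intro summable_mult summable_geometric) simp
qed

text \<open>
  The coefficients lie in \<open>[0, 1]\<close>, so the series converges on the unit interval; its sum \<open>f\<close> satisfies
  \<open>f' = K' f\<close> by the Cauchy product, hence \<open>f * exp (- K)\<close> is constant.
\<close>
lemma exp_coeff_sums:
  assumes "0 < x" "x < 1"
  shows "(\<lambda>n. exp_coeff n * x ^ n) sums exp (ellK (sqrt x) - pi / 2)"
proof -
  define k where "k = (\<lambda>x. \<Sum>n. ell_coeff n * x ^ n)"
  define f where "f = (\<lambda>x. \<Sum>n. exp_coeff n * x ^ n)"
  define k' where "k' = (\<lambda>x. \<Sum>n. diffs ell_coeff n * x ^ n)"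
  have f_sum: "summable (\<lambda>n. norm (exp_coeff n * z ^ n))" if "\<bar>z\<bar> < 1" for z
    using that exp_coeff_le_1 by (intro summable_bounded_powser[of _ 1]) (auto simp: less_imp_le)
  have "ell_coeff n \<le> pi / 2 * 1" for n
    unfolding ell_coeff_def by (intro mult_left_mono) (auto simp: power_le_one_iff abs_square_le_1 W_coeff_le_1 less_imp_le)
  then have k_sum: "summable (\<lambda>n. norm (ell_coeff n * z ^ n))" if "\<bar>z\<bar> < 1" for z
    using that by (intro summable_bounded_powser[of _ "pi / 2"]) (auto simp: less_imp_le)
  have k'_sum: "summable (\<lambda>n. norm (diffs ell_coeff n * z ^ n))" if "\<bar>z\<bar> < 1" for z
    using that weighted_ell_coeff_le[of "Suc _"]
    by (intro summable_bounded_powser[of _ "1 / 2"]) (auto simp: diffs_def less_imp_le abs_mult)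
  have dk: "(k has_field_derivative k' z) (at z)" if "\<bar>z\<bar> < 1" for z
    unfolding k_def k'_def using that k_sum
    by (intro termdiffs_strong'[where K = 1]) (auto intro: summable_norm_cancel)
  have "diffs exp_coeff n * z ^ n = (\<Sum>i\<le>n. (diffs ell_coeff i * z ^ i) * (exp_coeff (n - i) * z ^ (n - i)))" for n z
  proof -
    have "diffs exp_coeff n = (\<Sum>i\<le>n. diffs ell_coeff i * exp_coeff (n - i))"
      by (simp add: diffs_def exp_coeff.simps(2))
    then show ?thesis
      by (simp add: sum_distrib_right, intro sum.cong) (auto simp: power_add[symmetric] mult_ac)
  qed
  then have "(\<Sum>n. diffs exp_coeff n * z ^ n) = k' z * f z" if "\<bar>z\<bar> < 1" for z
    unfolding k'_def f_def using Cauchy_product[OF k'_sum f_sum, of z z] that by simp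
  moreover have "(f has_field_derivative (\<Sum>n. diffs exp_coeff n * z ^ n)) (at z)" if "\<bar>z\<bar> < 1" for z
    unfolding f_def using that f_sum
    by (intro termdiffs_strong'[where K = 1]) (auto intro: summable_norm_cancel)
  ultimately have df: "(f has_field_derivative k' z * f z) (at z)" if "\<bar>z\<bar> < 1" for z
    using that by metis
  define h where "h = (\<lambda>z. f z * exp (- k z))"
  have dh: "(h has_field_derivative 0) (at z)" if "\<bar>z\<bar> < 1" for z
    unfolding h_def using that by (auto intro!: derivative_eq_intros df dk)
  have "continuous_on {0..x} h"
    using assms by (intro continuous_at_imp_continuous_on ballI DERIV_isCont[OF dh]) auto
  then have "h x = h 0"
    using assms dh by (intro DERIV_isconst_end[of 0 x h]) auto
  moreover have "f 0 = 1" "k 0 = pi / 2"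
    unfolding f_def k_def powser_zero by (simp_all add: ell_coeff_def)
  ultimately have "f x * exp (- k x) = exp (- (pi / 2))" by (simp add: h_def)
  then have "f x * exp (- k x) * exp (k x) = exp (- (pi / 2)) * exp (k x)" by simp
  then have "f x = exp (k x - pi / 2)"
    by (simp add: mult.assoc exp_add[symmetric])
  moreover have "k x = ellK (sqrt x)"
    using ellK_sums[of x] assms unfolding k_def by (simp add: sums_iff)
  ultimately show ?thesis
    using summable_sums[OF summable_norm_cancel[OF f_sum[of x]]] assms unfolding f_def by simp
qed

text \<open>
  The two series are only known to agree to the right of 0. If the differences below index \<open>n\<close> vanish,
  dividing by \<open>x ^ n\<close> and letting \<open>x\<close> tend to 0 from the right shows that the \<open>n\<close>-th one vanishes too.
\<close>
lemma powser_coeffs_unique: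
  fixes a b :: "nat \<Rightarrow> real"
  assumes "\<And>x. 0 < x \<Longrightarrow> x < 1 \<Longrightarrow> (\<lambda>n. a n * x ^ n) sums f x"
    and "\<And>x. 0 < x \<Longrightarrow> x < 1 \<Longrightarrow> (\<lambda>n. b n * x ^ n) sums f x"
  shows "a = b"
proof
  fix n
  define d where "d = (\<lambda>n. a n - b n)"
  have d: "(\<lambda>n. d n * x ^ n) sums 0" if "0 < x" "x < 1" for x
    using sums_diff[OF assms(1)[OF that] assms(2)[OF that]] by (simp add: d_def algebra_simps)
  have "d n = 0"
  proof (induction n rule: less_induct)
    case (less n)
    \<comment> \<open>the series that remains after dividing by \<open>x ^ n\<close>; its constant term is \<open>d n\<close>\<close>
    define g where "g = (\<lambda>x. \<Sum>k. d (k + n) * x ^ k)"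
    have zero: "(\<lambda>k. d (k + n) * x ^ k) sums 0" if "0 < x" "x < 1" for x
    proof -
      have "(\<lambda>k. d (k + n) * x ^ (k + n)) sums (0 - (\<Sum>i<n. d i * x ^ i))"
        by (rule sums_split_initial_segment[OF d[OF that]])
      then have "(\<lambda>k. d (k + n) * x ^ (k + n)) sums 0"
        using less by simp
      from sums_mult2[OF this, of "1 / x ^ n"] show ?thesis
        using that by (simp add: power_add)
    qed
    have "isCont g 0"
      unfolding g_def using zero[of "1/2"] by (intro isCont_powser[of _ "1/2"]) (auto simp: sums_iff)
    then have "(g \<longlongrightarrow> g 0) (at_right 0)"
      by (simp add: isCont_def filterlim_at_split)
    moreover have "eventually (\<lambda>x. g x = 0) (at_right 0)"
      using zero unfolding eventually_at_right_field g_def by (auto simp: sums_iff intro!: exI[of _ 1])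
    then have "(g \<longlongrightarrow> 0) (at_right 0)"
      by (rule tendsto_eventually)
    ultimately have "g 0 = 0" by (rule tendsto_unique[rotated]) simp
    then show ?case unfolding g_def by simp
  qed
  then show "a n = b n" by (simp add: d_def)
qed

lemma scaled_exp_coeff_sums:
  assumes "0 < x" "x < 1"
  shows "(\<lambda>n. exp (pi / 2) * exp_coeff n * x ^ n) sums exp (ellK (sqrt x))"
proof -
  have "exp (pi / 2) * exp (ellK (sqrt x) - pi / 2) = exp (ellK (sqrt x))"
    by (subst exp_add[symmetric]) simp
  with sums_mult[OF exp_coeff_sums[OF assms], of "exp (pi / 2)"] show ?thesis
    by (simp only: mult.assoc)
qed

lemma b_coeff_eq: "b_coeff n = exp (pi / 2) * exp_coeff n"
proof -
  have "b_coeff = (\<lambda>n. exp (pi / 2) * exp_coeff n)"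
    unfolding b_coeff_def
  proof (rule the_equality)
    show "\<forall>x\<in>{0<..<1}. (\<lambda>n. exp (pi / 2) * exp_coeff n * x ^ n) sums exp (ellK (sqrt x))"
      using scaled_exp_coeff_sums by auto
    then show "a = (\<lambda>n. exp (pi / 2) * exp_coeff n)"
      if "\<forall>x\<in>{0<..<1}. (\<lambda>n. a n * x ^ n) sums exp (ellK (sqrt x))" for a
      using that by (intro powser_coeffs_unique[where f = "\<lambda>x. exp (ellK (sqrt x))"]) auto
  qed
  then show ?thesis by (rule fun_cong)
qed

section \<open>The increments of the weighted coefficients\<close>

text \<open>
  The coefficients of \<open>(1 - x) K' f\<close>, hence of \<open>(1 - x) f'\<close>.
\<close>
definition step_conv :: "nat \<Rightarrow> real" where
  "step_conv n = (\<Sum>k\<le>n. ell_step k * exp_coeff (n - k))"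

lemma exp_coeff_step: "real (Suc n) * exp_coeff (Suc n) = real n * exp_coeff n + step_conv n"
proof -
  have "real n * exp_coeff n = (\<Sum>k\<le>n. real k * ell_coeff k * exp_coeff (n - k))"
  proof (cases n)
    case (Suc m)
    show ?thesis
      unfolding Suc by (subst sum.atMost_Suc_shift) (simp add: exp_coeff.simps(2))
  qed simp
  moreover have "real (Suc n) * exp_coeff (Suc n)
      = (\<Sum>k\<le>n. real (Suc k) * ell_coeff (Suc k) * exp_coeff (n - k))"
    by (simp add: exp_coeff.simps(2))
  ultimately show ?thesis
    by (simp add: step_conv_def ell_step_eq left_diff_distrib sum_subtractf)
qed

section \<open>The small indices, by integer interval arithmetic\<close>

definition enc_scale :: int where "enc_scale = 1000000"

text \<open>
  One relation serves for lower bounds (mode \<open>c = 0\<close>) and upper bounds (mode \<open>c = 1\<close>), so that soundness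
  of the arithmetic is proved once: integer division followed by adding \<open>c\<close> rounds in the right
  direction in both modes. Nonnegativity is part of it because bounds are multiplied.
\<close>
definition encloses :: "int \<Rightarrow> int \<Rightarrow> real \<Rightarrow> bool" where
  "encloses c x y \<longleftrightarrow> 0 \<le> x \<and> 0 \<le> y \<and> (c = 0 \<and> real_of_int x \<le> y \<or> c = 1 \<and> y \<le> real_of_int x)"

text \<open>
  Bounds for \<open>ell_step\<close>, \<open>step_conv\<close> and \<open>exp_coeff\<close>, all multiplied by \<open>enc_scale\<close>, obtained by running
  the recurrences \<open>ell_step_Suc\<close> and \<open>exp_coeff_step\<close> with rounding. The parameter \<open>p\<close> is a bound
  for \<open>1000 * pi\<close>. The list \<open>exp_enc c ds n\<close> has the bound for \<open>exp_coeff n\<close> at its head and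
  that for \<open>exp_coeff 0\<close> at its end, so that the convolution is a pairing of two lists from the front.
\<close>
primrec step_enc :: "int \<Rightarrow> int \<Rightarrow> nat \<Rightarrow> int" where
  "step_enc c p 0 = enc_scale * p div 8000 + c"
| "step_enc c p (Suc k) = step_enc c p k * (2 * int k + 1)\<^sup>2 div (4 * (int k + 1) * (int k + 2)) + c"

definition conv_enc :: "int \<Rightarrow> int list \<Rightarrow> int list \<Rightarrow> int" where
  "conv_enc c ds bs = sum_list (map2 (*) ds bs) div enc_scale + c"

primrec exp_enc :: "int \<Rightarrow> int list \<Rightarrow> nat \<Rightarrow> int list" where
  "exp_enc c ds 0 = [enc_scale]"
| "exp_enc c ds (Suc n) =
     (let bs = exp_enc c ds n
      in ((int n * hd bs + conv_enc c ds bs) div (int n + 1) + c) # bs)"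

text \<open>
  The strict inequalities \<open>B n < 2 S n\<close> and \<open>S n < (29/50) B n\<close> for \<open>1 \<le> n < 20\<close>, each tested on the unfavourable
  bounds. Dropping \<open>k\<close> entries of a list computed up to index 19 gives the list for \<open>n = 19 - k\<close>.
\<close>
definition window_check :: bool where
  "window_check = (let dl = map (step_enc 0 3140) [0..<20]; du = map (step_enc 1 3143) [0..<20];
       bl = exp_enc 0 dl 19; bu = exp_enc 1 du 19 in
     list_all (\<lambda>k. let l = drop k bl; u = drop k bu in
        hd u < 2 * conv_enc 0 dl l \<and> 50 * conv_enc 1 du u < 29 * hd l) [0..<19])"

lemma window_check_holds: window_check
  by code_simp

lemma encloses_mult: "encloses c x y \<Longrightarrow> encloses c x' y' \<Longrightarrow> encloses c (x * x') (y * y')"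
  unfolding encloses_def by (auto intro!: mult_mono)

lemma encloses_add: "encloses c x y \<Longrightarrow> encloses c x' y' \<Longrightarrow> encloses c (x + x') (y + y')"
  unfolding encloses_def by auto

lemma encloses_exact: "x \<ge> 0 \<Longrightarrow> c = 0 \<or> c = 1 \<Longrightarrow> encloses c x (real_of_int x)"
  unfolding encloses_def by auto

lemma encloses_sum:
  assumes "finite A" "c = 0 \<or> c = 1" "\<And>i. i \<in> A \<Longrightarrow> encloses c (f i) (g i)"
  shows "encloses c (\<Sum>i\<in>A. f i) (\<Sum>i\<in>A. g i)"
  using assms(1,3)
proof (induction A rule: finite_induct)
  case empty
  then show ?case using assms(2) by (auto simp: encloses_def)
next
  case (insert a A)
  then show ?case by (simp add: encloses_add)
qed

lemma encloses_div:
  assumes "encloses c x y" "d > 0"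
  shows "encloses c (x div d + c) (y / real_of_int d)"
proof -
  have "real_of_int (x div d) \<le> real_of_int x / real_of_int d"
    by (rule real_of_int_div4)
  moreover have "real_of_int x / real_of_int d \<le> real_of_int (x div d) + 1"
    using real_of_int_div3[of x d] by linarith
  moreover have "x div d \<ge> 0" "y / real_of_int d \<ge> 0"
    using assms by (auto simp: encloses_def pos_imp_zdiv_nonneg_iff)
  moreover have "c = 0 \<Longrightarrow> real_of_int x / real_of_int d \<le> y / real_of_int d"
    "c = 1 \<Longrightarrow> y / real_of_int d \<le> real_of_int x / real_of_int d"
    using assms by (auto simp: encloses_def divide_right_mono)
  ultimately show ?thesis
    using assms unfolding encloses_def by auto
qed

lemma encloses_step:
  assumes "encloses c p (1000 * pi)"
  shows "encloses c (step_enc c p k) (real_of_int enc_scale * ell_step k)"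
proof (induction k)
  case 0
  have c: "c = 0 \<or> c = 1" using assms by (auto simp: encloses_def)
  have "encloses c (enc_scale * p div 8000 + c) (real_of_int enc_scale * (1000 * pi) / real_of_int 8000)"
    by (intro encloses_div encloses_mult encloses_exact assms c) (auto simp: enc_scale_def)
  then show ?case by (simp add: ell_step_0 mult.commute)
next
  case (Suc k)
  have c: "c = 0 \<or> c = 1" using assms by (auto simp: encloses_def)
  have "encloses c (step_enc c p (Suc k))
      (real_of_int enc_scale * ell_step k * real_of_int ((2 * int k + 1)\<^sup>2) / real_of_int (4 * (int k + 1) * (int k + 2)))"
    unfolding step_enc.simps by (intro encloses_div encloses_mult encloses_exact Suc c) auto
  then show ?case by (simp add: ell_step_Suc mult.assoc)
qed

lemma encloses_conv:
  assumes "c = 0 \<or> c = 1" "length bs = Suc n" "n < length ds"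
    and "\<And>i. i \<le> n \<Longrightarrow> encloses c (ds ! i) (real_of_int enc_scale * ell_step i)"
    and "\<And>i. i \<le> n \<Longrightarrow> encloses c (bs ! i) (real_of_int enc_scale * exp_coeff (n - i))"
  shows "encloses c (conv_enc c ds bs) (real_of_int enc_scale * step_conv n)"
proof -
  have "min (length ds) (length bs) = Suc n"
    using assms(2,3) by simp
  then have "sum_list (map2 (*) ds bs) = (\<Sum>i\<le>n. ds ! i * bs ! i)"
    by (simp add: sum_list_sum_nth lessThan_Suc_atMost atLeast0LessThan)
  moreover have "encloses c ((\<Sum>i\<le>n. ds ! i * bs ! i) div enc_scale + c)
     ((\<Sum>i\<le>n. (real_of_int enc_scale * ell_step i) * (real_of_int enc_scale * exp_coeff (n - i))) / real_of_int enc_scale)"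
    using assms by (intro encloses_div encloses_sum encloses_mult) (auto simp: enc_scale_def)
  moreover have "(\<Sum>i\<le>n. (real_of_int enc_scale * ell_step i) * (real_of_int enc_scale * exp_coeff (n - i))) / real_of_int enc_scale
      = real_of_int enc_scale * step_conv n"
    by (simp add: step_conv_def enc_scale_def sum_distrib_left sum_distrib_right sum_divide_distrib mult_ac)
  ultimately show ?thesis by (simp add: conv_enc_def)
qed

lemma length_exp_enc [simp]: "length (exp_enc c ds n) = Suc n"
  by (induction n) (auto simp: Let_def)

lemma encloses_exp:
  assumes "c = 0 \<or> c = 1" "n \<le> length ds"
    and "\<And>i. i < length ds \<Longrightarrow> encloses c (ds ! i) (real_of_int enc_scale * ell_step i)"
    and "i \<le> n"
  shows "encloses c (exp_enc c ds n ! i) (real_of_int enc_scale * exp_coeff (n - i))"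
  using assms(2,4)
proof (induction n arbitrary: i)
  case 0
  then show ?case using assms(1) by (auto simp: encloses_def enc_scale_def)
next
  case (Suc n)
  let ?bs = "exp_enc c ds n"
  have IH: "\<And>i. i \<le> n \<Longrightarrow> encloses c (?bs ! i) (real_of_int enc_scale * exp_coeff (n - i))"
    using Suc by simp
  have "hd ?bs = ?bs ! 0" by (metis length_exp_enc hd_conv_nth list.size(3) nat.distinct(1))
  then have hd: "encloses c (hd ?bs) (real_of_int enc_scale * exp_coeff n)" using IH[of 0] by simp
  have conv: "encloses c (conv_enc c ds ?bs) (real_of_int enc_scale * step_conv n)"
    using Suc.prems assms(1,3) IH by (intro encloses_conv) auto
  have "encloses c ((int n * hd ?bs + conv_enc c ds ?bs) div (int n + 1) + c)
      ((real_of_int (int n) * (real_of_int enc_scale * exp_coeff n) + real_of_int enc_scale * step_conv n) / real_of_int (int n + 1))"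
    using assms(1) by (intro encloses_div encloses_add encloses_mult encloses_exact hd conv) auto
  also have "(real_of_int (int n) * (real_of_int enc_scale * exp_coeff n) + real_of_int enc_scale * step_conv n) / real_of_int (int n + 1)
      = real_of_int enc_scale * exp_coeff (Suc n)"
    using exp_coeff_step[of n] by (simp add: field_simps)
  finally show ?case
    using IH Suc.prems by (cases i) (auto simp: Let_def)
qed

lemma drop_exp_enc: "drop k (exp_enc c ds (k + n)) = exp_enc c ds n"
  by (induction k) (auto simp: Let_def)

lemma step_conv_window_small:
  assumes "1 \<le> n" "n < 20"
  shows "exp_coeff n < 2 * step_conv n" "50 * step_conv n < 29 * exp_coeff n"
proof -
  define dl where "dl = map (step_enc 0 3140) [0..<20]"
  define du where "du = map (step_enc 1 3143) [0..<20]"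
  define l where "l = exp_enc 0 dl n"
  define u where "u = exp_enc 1 du n"
  have dl: "encloses 0 (dl ! i) (real_of_int enc_scale * ell_step i)" if "i < length dl" for i
    using that encloses_step[of 0 3140] pi_bounds by (simp add: dl_def encloses_def)
  have du: "encloses 1 (du ! i) (real_of_int enc_scale * ell_step i)" if "i < length du" for i
    using that encloses_step[of 1 3143] pi_bounds by (simp add: du_def encloses_def)
  have hd_nth: "hd (exp_enc c ds n) = exp_enc c ds n ! 0" for c ds
    by (metis length_exp_enc hd_conv_nth list.size(3) nat.distinct(1))
  have hl: "encloses 0 (hd l) (real_of_int enc_scale * exp_coeff n)"
    unfolding l_def hd_nth using encloses_exp[of 0 n dl 0] dl assms by (simp add: dl_def)
  have hu: "encloses 1 (hd u) (real_of_int enc_scale * exp_coeff n)"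
    unfolding u_def hd_nth using encloses_exp[of 1 n du 0] du assms by (simp add: du_def)
  have cl: "encloses 0 (conv_enc 0 dl l) (real_of_int enc_scale * step_conv n)"
    using assms dl unfolding l_def by (intro encloses_conv encloses_exp) (auto simp: dl_def)
  have cu: "encloses 1 (conv_enc 1 du u) (real_of_int enc_scale * step_conv n)"
    using assms du unfolding u_def by (intro encloses_conv encloses_exp) (auto simp: du_def)
  have drops: "drop (19 - n) (exp_enc 0 dl 19) = l" "drop (19 - n) (exp_enc 1 du 19) = u"
    using drop_exp_enc[of "19 - n" _ _ n] assms by (simp_all add: l_def u_def)
  have "19 - n \<in> set [0..<19]" using assms by auto
  with window_check_holds have "hd u < 2 * conv_enc 0 dl l \<and> 50 * conv_enc 1 du u < 29 * hd l"
    unfolding window_check_def list_all_iff Let_def dl_def[symmetric] du_def[symmetric]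
    using drops by metis
  then have "real_of_int (hd u) < 2 * real_of_int (conv_enc 0 dl l)"
    "50 * real_of_int (conv_enc 1 du u) < 29 * real_of_int (hd l)" by linarith+
  then show "exp_coeff n < 2 * step_conv n" "50 * step_conv n < 29 * exp_coeff n"
    using hl hu cl cu by (auto simp: encloses_def enc_scale_def)
qed

section \<open>The large indices, and monotonicity of the coefficient ratio\<close>

lemma step_conv_nonneg: "step_conv n \<ge> 0"
  unfolding step_conv_def by (intro sum_nonneg mult_nonneg_nonneg) (auto simp: less_imp_le)

lemma exp_coeff_weighted_mono: "j \<le> n \<Longrightarrow> real j * exp_coeff j \<le> real n * exp_coeff n"
  by (rule lift_Suc_mono_le[of "\<lambda>n. real n * exp_coeff n"])
     (use exp_coeff_step step_conv_nonneg in \<open>auto simp del: of_nat_Suc\<close>)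

lemma weighted_ell_step: "real k * ell_step k = real k * ell_coeff k / (4 * (real k + 1))"
  by (simp add: ell_step_def)

lemma weighted_ell_step_le: "real k * ell_step k \<le> 1 / (8 * (real k + 1))"
proof -
  have "real k * ell_coeff k / (4 * (real k + 1)) \<le> (1 / 2) / (4 * (real k + 1))"
    by (intro divide_right_mono weighted_ell_coeff_le) simp
  then show ?thesis unfolding weighted_ell_step by simp
qed

text \<open>
  Any linear bound with a small slope does; the slope \<open>1/5\<close> is small enough for
  \<open>step_conv_le_large\<close> and valid from \<open>n = 20\<close> on.
\<close>
lemma harm_le_linear: "n \<ge> 20 \<Longrightarrow> (harm n :: real) \<le> (real n + 1) / 5"
proof (induction n rule: dec_induct)
  case base
  then show ?case by (simp add: harm_def numeral_eq_Suc)
next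
  case (step n)
  have "inverse (real (Suc n)) \<le> 1 / 5" using step by (simp add: field_simps)
  then show ?case using step by (simp add: harm_Suc add_divide_distrib)
qed

lemma reciprocal_convolution: "(\<Sum>k<n. 1 / ((real k + 1) * real (n - k))) = 2 * harm n / (real n + 1)"
proof -
  have "(\<Sum>k<n. 1 / ((real k + 1) * real (n - k))) =
        (\<Sum>k<n. (1 / real (Suc k) + 1 / real (n - k)) / (real n + 1))"
  proof (intro sum.cong refl)
    fix k assume "k \<in> {..<n}"
    then obtain r where "n = r + k" "r > 0" using less_imp_add_positive[of k n] by auto
    then show "1 / ((real k + 1) * real (n - k)) = (1 / real (Suc k) + 1 / real (n - k)) / (real n + 1)"
      by (simp add: divide_simps) (simp add: algebra_simps)
  qed
  also have "\<dots> = ((\<Sum>k<n. 1 / real (Suc k)) + (\<Sum>k<n. 1 / real (n - k))) / (real n + 1)"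
    by (simp only: sum_divide_distrib[symmetric] sum.distrib)
  also have "(\<Sum>k<n. 1 / real (n - k)) = (\<Sum>k<n. 1 / real (Suc (n - Suc k)))"
    by (intro sum.cong) (auto simp: Suc_diff_Suc)
  also have "\<dots> = (\<Sum>k<n. 1 / real (Suc k))"
    by (rule sum.nat_diff_reindex)
  also have "(\<Sum>k<n. 1 / real (Suc k)) = harm n"
    by (simp add: harm_def sum.atLeast1_atMost_eq inverse_eq_divide)
  finally show ?thesis by simp
qed

text \<open>
  Because \<open>n * exp_coeff n\<close> increases, \<open>exp_coeff (n - k) \<le> exp_coeff n * (1 + k / (n - k))\<close> for \<open>k < n\<close>. The
  leading 1 contributes at most the total mass \<open>1/2\<close> of \<open>ell_step\<close>, the correction a convolution of
  reciprocals of size \<open>harm n / n\<close>. The term \<open>k = n\<close> is separate and small, since \<open>exp_coeff n\<close> is at least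
  \<open>exp_coeff 1 / n\<close>.
\<close>
lemma step_conv_le_large:
  assumes "n \<ge> 20"
  shows "step_conv n \<le> 0.58 * exp_coeff n"
proof -
  have n: "real n \<ge> 20" using assms by simp
  have "step_conv n = (\<Sum>k<n. ell_step k * exp_coeff (n - k)) + ell_step n"
    by (simp add: step_conv_def lessThan_Suc_atMost[symmetric])
  also have "(\<Sum>k<n. ell_step k * exp_coeff (n - k))
      \<le> (\<Sum>k<n. exp_coeff n * (ell_step k + (1 / 8) * (1 / ((real k + 1) * real (n - k)))))"
  proof (rule sum_mono)
    fix k assume "k \<in> {..<n}"
    define r where "r = n - k"
    with \<open>k \<in> {..<n}\<close> have k: "real r > 0" "n = r + k" by auto
    have diff: "n - k = r" by (simp add: r_def)
    have "exp_coeff r \<le> exp_coeff n * (real n / real r)"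
      using exp_coeff_weighted_mono[of r n] k by (simp add: field_simps)
    also have "real n / real r = 1 + real k / real r"
      using k by (simp add: field_simps)
    finally have "ell_step k * exp_coeff r \<le> ell_step k * (exp_coeff n * (1 + real k / real r))"
      by (intro mult_left_mono) (auto simp: less_imp_le)
    also have "\<dots> = exp_coeff n * (ell_step k + (real k * ell_step k) / real r)"
      by (simp add: field_simps)
    also have "\<dots> \<le> exp_coeff n * (ell_step k + (1 / (8 * (real k + 1))) / real r)"
      using k by (intro mult_left_mono add_left_mono divide_right_mono weighted_ell_step_le)
                 (auto simp: less_imp_le)
    also have "1 / (8 * (real k + 1)) / real r = (1 / 8) * (1 / ((real k + 1) * real r))"
      using k by (simp add: field_simps)
    finally show "ell_step k * exp_coeff (n - k)
        \<le> exp_coeff n * (ell_step k + (1 / 8) * (1 / ((real k + 1) * real (n - k))))"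
      unfolding diff .
  qed
  also have "\<dots> = exp_coeff n * ((\<Sum>k<n. ell_step k) + (1 / 8) * (\<Sum>k<n. 1 / ((real k + 1) * real (n - k))))"
    by (simp only: sum_distrib_left[symmetric] sum.distrib)
  also have "\<dots> = exp_coeff n * (real n * ell_coeff n + (1 / 4) * (harm n / (real n + 1)))"
    by (simp only: sum_ell_step reciprocal_convolution) simp
  also have "\<dots> \<le> exp_coeff n * (1 / 2 + (1 / 4) * (1 / 5))"
    using harm_le_linear[OF assms] n
    by (intro mult_left_mono add_mono weighted_ell_coeff_le) (auto simp: less_imp_le field_simps)
  also have "ell_step n \<le> exp_coeff n / 63"
  proof -
    have B1: "exp_coeff (Suc 0) = pi / 8"
      using exp_coeff_step[of 0] by (simp add: step_conv_def ell_step_0)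
    have "1 \<le> 8 / 3 * (real n * exp_coeff n)"
      using exp_coeff_weighted_mono[of 1 n] assms pi_bounds by (simp add: B1)
    then have "ell_step n * 1 \<le> ell_step n * (8 / 3 * (real n * exp_coeff n))"
      by (intro mult_left_mono) (auto simp: less_imp_le)
    also have "\<dots> = 8 / 3 * exp_coeff n * (real n * ell_step n)" by simp
    also have "\<dots> \<le> 8 / 3 * exp_coeff n * (1 / (8 * (real n + 1)))"
      by (intro mult_left_mono weighted_ell_step_le) (auto simp: less_imp_le)
    also have "\<dots> \<le> 8 / 3 * exp_coeff n * (1 / (8 * 21))"
      using n by (intro mult_left_mono divide_left_mono) (auto simp: less_imp_le)
    finally show ?thesis by simp
  qed
  finally have "step_conv n \<le> exp_coeff n * (1 / 2 + (1 / 4) * (1 / 5)) + exp_coeff n / 63" by simp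
  \<comment> \<open>\<open>713/1260 = 1/2 + 1/20 + 1/63\<close>\<close>
  then have "step_conv n \<le> 713 / 1260 * exp_coeff n" by simp
  also have "\<dots> \<le> 0.58 * exp_coeff n"
    by (intro mult_right_mono) (auto simp: less_imp_le)
  finally show ?thesis .
qed

lemma step_conv_le: "step_conv n \<le> 0.58 * exp_coeff n"
proof -
  consider "n = 0" | "1 \<le> n" "n < 20" | "n \<ge> 20" by linarith
  then show ?thesis
  proof cases
    case 1
    then show ?thesis using pi_bounds by (simp add: step_conv_def ell_step_0)
  next
    case 2
    then show ?thesis using step_conv_window_small(2)[of n] by simp
  next
    case 3
    then show ?thesis by (rule step_conv_le_large)
  qed
qed

text \<open>
  The crude upper bound \<open>0.58\<close> on \<open>step_conv n / exp_coeff n\<close> turned into a lower bound on the rate of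
  decrease; \<open>0.42 = 1 - 0.58\<close>.
\<close>
lemma exp_coeff_ratio_ge: "exp_coeff n \<ge> exp_coeff (Suc n) * (1 + 0.42 / real (Suc n))"
proof -
  have "real (Suc n) * exp_coeff (Suc n) \<le> (real (Suc n) - 0.42) * exp_coeff n"
    using exp_coeff_step[of n] step_conv_le[of n] by (simp add: algebra_simps)
  then have "exp_coeff (Suc n) \<le> exp_coeff n * (1 - 0.42 / real (Suc n))"
    by (simp add: field_simps)
  then have "exp_coeff (Suc n) * (1 + 0.42 / real (Suc n))
      \<le> exp_coeff n * (1 - 0.42 / real (Suc n)) * (1 + 0.42 / real (Suc n))"
    by (intro mult_right_mono) auto
  also have "\<dots> = exp_coeff n * (1 - (0.42 / real (Suc n))\<^sup>2)"
    by (simp only: power2_eq_square) algebra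
  also have "\<dots> \<le> exp_coeff n * 1"
    by (intro mult_left_mono) (auto simp: less_imp_le)
  finally show ?thesis by simp
qed

lemma exp_coeff_backward_growth:
  assumes "k \<le> n"
  shows "exp_coeff (n - k) \<ge> exp_coeff n * (1 + 0.42 * (real k / real n))"
  using assms
proof (induction k)
  case (Suc k)
  define j where "j = n - Suc k"
  have j: "n - k = Suc j" "Suc j \<le> n" using Suc.prems by (auto simp: j_def)
  have IH: "exp_coeff n * (1 + 0.42 * (real k / real n)) \<le> exp_coeff (Suc j)"
    using Suc j by simp
  have "exp_coeff n * 1 \<le> exp_coeff n * (1 + 0.42 * (real k / real n))"
    by (intro mult_left_mono) (auto simp: less_imp_le)
  with IH have le: "exp_coeff n \<le> exp_coeff (Suc j)" by linarith
  have "exp_coeff n * (1 + 0.42 * (real (Suc k) / real n))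
      = exp_coeff n * (1 + 0.42 * (real k / real n)) + exp_coeff n * (0.42 / real n)"
    by (simp add: algebra_simps add_divide_distrib)
  also have "\<dots> \<le> exp_coeff (Suc j) + exp_coeff (Suc j) * (0.42 / real (Suc j))"
    using j by (intro add_mono IH mult_mono le divide_left_mono) (auto simp: less_imp_le)
  also have "\<dots> \<le> exp_coeff j"
    using exp_coeff_ratio_ge[of j] by (simp add: algebra_simps)
  finally show ?case by (simp add: j_def)
qed simp

text \<open>
  By \<open>weighted_ell_coeff_ge\<close> the terms behave like \<open>1 / (8 k)\<close>; the first twenty already suffice.
\<close>
lemma weighted_ell_step_sum_ge:
  assumes "n \<ge> 20"
  shows "(\<Sum>k\<le>n. real k * ell_step k) \<ge> 0.3"
proof -
  have "0.3 \<le> (\<Sum>k=1..20. (1 / 2 - 1 / (8 * real k)) / (4 * (real k + 1)))"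
    by (simp add: numeral_eq_Suc)
  also have "\<dots> \<le> (\<Sum>k=1..20. real k * ell_step k)"
  proof (rule sum_mono)
    fix k :: nat assume "k \<in> {1..20}"
    then show "(1 / 2 - 1 / (8 * real k)) / (4 * (real k + 1)) \<le> real k * ell_step k"
      unfolding weighted_ell_step by (intro divide_right_mono weighted_ell_coeff_ge) auto
  qed
  also have "\<dots> \<le> (\<Sum>k\<le>n. real k * ell_step k)"
    using assms by (intro sum_mono2) (auto simp: less_imp_le)
  finally show ?thesis .
qed

text \<open>
  The weights \<open>ell_step k\<close> for \<open>k \<le> n\<close> have total mass at least \<open>1/2 - 1 / (8 (n + 1))\<close>. The growth factor
  \<open>1 + 0.42 k / n\<close> of \<open>exp_coeff (n - k)\<close> adds at least \<open>0.42 * 0.3 / n = 0.126 / n\<close>, just more than the missing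
  \<open>0.125 / (n + 1)\<close>.
\<close>
lemma step_conv_gt_large:
  assumes "n \<ge> 20"
  shows "step_conv n > exp_coeff n / 2"
proof -
  have n: "real n \<ge> 20" using assms by simp
  have "1 / (8 * real (Suc n)) \<le> 1 / (8 * real n)"
    using n by (intro divide_left_mono) auto
  also have "\<dots> < 0.42 / real n * 0.3"
    using n by (simp add: field_simps)
  finally have "1 / 2 < 1 / 2 - 1 / (8 * real (Suc n)) + 0.42 / real n * 0.3"
    by simp
  also have "\<dots> \<le> real (Suc n) * ell_coeff (Suc n) + 0.42 / real n * (\<Sum>k\<le>n. real k * ell_step k)"
    using n by (intro add_mono weighted_ell_coeff_ge mult_left_mono weighted_ell_step_sum_ge assms) auto
  also have "\<dots> = (\<Sum>k\<le>n. ell_step k * (1 + 0.42 * (real k / real n)))"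
    by (simp only: sum_ell_step[symmetric] lessThan_Suc_atMost distrib_left sum.distrib sum_distrib_left)
       (simp add: mult_ac)
  finally have "exp_coeff n * (1 / 2) < exp_coeff n * (\<Sum>k\<le>n. ell_step k * (1 + 0.42 * (real k / real n)))"
    by (rule mult_strict_left_mono) simp
  also have "\<dots> = (\<Sum>k\<le>n. ell_step k * (exp_coeff n * (1 + 0.42 * (real k / real n))))"
    by (simp add: sum_distrib_left mult_ac)
  also have "\<dots> \<le> step_conv n"
    unfolding step_conv_def
    by (intro sum_mono mult_left_mono exp_coeff_backward_growth) (auto simp: less_imp_le)
  finally show ?thesis by simp
qed

lemma step_conv_gt: "n \<ge> 1 \<Longrightarrow> step_conv n > exp_coeff n / 2"
  using step_conv_window_small(1)[of n] step_conv_gt_large[of n] by (cases "n < 20") auto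

lemma exp_coeff_ratio_increasing:
  assumes "n \<ge> 1"
  shows "exp_coeff n / W_coeff n < exp_coeff (Suc n) / W_coeff (Suc n)"
proof -
  have "(real n + 1 / 2) * exp_coeff n < real (Suc n) * exp_coeff (Suc n)"
    using step_conv_gt[OF assms] exp_coeff_step[of n] by (simp add: algebra_simps)
  then have "(2 * real n + 1) / (2 * real n + 2) * exp_coeff n < exp_coeff (Suc n)"
    by (simp add: field_simps)
  then have "exp_coeff n < exp_coeff (Suc n) / ((2 * real n + 1) / (2 * real n + 2))"
    by (subst pos_less_divide_eq) (auto simp: mult.commute)
  then have "exp_coeff n / W_coeff n < exp_coeff (Suc n) / ((2 * real n + 1) / (2 * real n + 2)) / W_coeff n"
    by (intro divide_strict_right_mono) auto
  then show ?thesis by (simp add: W_coeff_Suc mult_ac)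
qed

lemma exp_coeff_ratio_strict_mono:
  assumes "1 \<le> m" "m < n"
  shows "exp_coeff m / W_coeff m < exp_coeff n / W_coeff n"
proof -
  have "exp_coeff m / W_coeff m < exp_coeff (m + Suc k) / W_coeff (m + Suc k)" for k
  proof (induction k)
    case 0
    show ?case using exp_coeff_ratio_increasing[OF assms(1)] by simp
  next
    case (Suc k)
    also have "exp_coeff (m + Suc k) / W_coeff (m + Suc k) < exp_coeff (m + Suc (Suc k)) / W_coeff (m + Suc (Suc k))"
      using exp_coeff_ratio_increasing[of "m + Suc k"] by simp
    finally show ?case .
  qed
  from this[of "n - Suc m"] assms show ?thesis by simp
qed

section \<open>The limit of the coefficient ratio\<close>

text \<open>
  Split the numerator 1 of the integrand as \<open>sin t + (1 - sin t)\<close>. The first part has an elementary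
  antiderivative; in the second the root may be replaced by the smaller \<open>cos t\<close>, which leaves
  \<open>cos t / (1 + sin t)\<close>. As \<open>r\<close> tends to 1 this loses nothing in the constant of
  \<open>ellK r = ln (4 / sqrt (1 - r^2)) + o(1)\<close>.
\<close>
lemma ellK_le:
  assumes "0 < r" "r < 1"
  shows "ellK r \<le> ln 2 + (1 / r) * ln ((1 + r) / sqrt (1 - r\<^sup>2))"
proof -
  define q where "q = (\<lambda>t. sqrt (1 - r\<^sup>2 * (sin t)\<^sup>2))"
  define G where "G = (\<lambda>t. ln (1 + sin t) - (1 / r) * ln (r * cos t + q t))"
  have r2: "r\<^sup>2 < 1" using assms by (simp add: power_less_one_iff abs_square_less_1)
  have rad: "1 - r\<^sup>2 * (sin t)\<^sup>2 > 0" for t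
  proof -
    have "r\<^sup>2 * (sin t)\<^sup>2 \<le> r\<^sup>2 * 1" by (intro mult_left_mono) (auto simp: abs_square_le_1)
    then show ?thesis using r2 by simp
  qed
  then have q_pos: "q t > 0" for t by (simp add: q_def)
  have q_sq: "(q t)\<^sup>2 = 1 - r\<^sup>2 * (sin t)\<^sup>2" for t using rad[of t] by (simp add: q_def)
  have trig: "0 \<le> sin t" "0 \<le> cos t" "sin t \<le> 1" if "t \<in> {0..pi/2}" for t
    using that by (auto intro!: sin_ge_zero cos_ge_zero)
  have upper: "((\<lambda>t. cos t / (1 + sin t) + sin t / q t) has_integral (G (pi/2) - G 0)) {0..pi/2}"
  proof (rule fundamental_theorem_of_calculus)
    fix t assume t: "t \<in> {0..pi/2}"
    have pos: "1 + sin t > 0" "r * cos t + q t > 0"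
      using trig[OF t] q_pos[of t] assms by (auto intro!: add_nonneg_pos mult_nonneg_nonneg)
    have dq: "(q has_real_derivative (- (r\<^sup>2 * sin t * cos t) / q t)) (at t within {0..pi/2})"
      unfolding q_def using rad[of t]
      by (auto intro!: derivative_eq_intros simp: field_simps)
    have "(G has_real_derivative cos t / (1 + sin t)
        - (1 / r) * ((r * (- sin t) + (- (r\<^sup>2 * sin t * cos t) / q t)) / (r * cos t + q t))) (at t within {0..pi/2})"
      unfolding G_def using pos assms
      by (auto intro!: derivative_eq_intros dq simp: mult.commute)
    also have "(r * (- sin t) + (- (r\<^sup>2 * sin t * cos t) / q t)) = - (r * sin t / q t) * (r * cos t + q t)"
      using q_pos[of t] by (simp add: field_simps power2_eq_square)
    also have "cos t / (1 + sin t) - (1 / r) * (- (r * sin t / q t) * (r * cos t + q t) / (r * cos t + q t))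
        = cos t / (1 + sin t) + sin t / q t"
      using pos assms by simp
    finally show "(G has_vector_derivative cos t / (1 + sin t) + sin t / q t) (at t within {0..pi/2})"
      by (simp add: has_real_derivative_iff_has_vector_derivative)
  qed simp
  have int: "((\<lambda>t. 1 / q t) has_integral ellK r) {0..pi/2}"
    unfolding ellK_def q_def using rad
    by (intro integrable_integral integrable_continuous_real continuous_intros) (auto simp: less_imp_neq[symmetric])
  have le: "1 / q t \<le> cos t / (1 + sin t) + sin t / q t" if t: "t \<in> {0..pi/2}" for t
  proof -
    have "r\<^sup>2 * (sin t)\<^sup>2 \<le> 1 * (sin t)\<^sup>2"
      using r2 by (intro mult_right_mono) auto
    then have "(cos t)\<^sup>2 \<le> (q t)\<^sup>2"
      unfolding q_sq cos_squared_eq by simp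
    then have "cos t \<le> q t" 
      by (rule power2_le_imp_le) (use q_pos[of t] in simp)
    then have "cos t * cos t \<le> cos t * q t" using trig[OF t] by (intro mult_left_mono)
    moreover have "(1 - sin t) * (1 + sin t) = 1 - sin t * sin t"
      by (simp add: algebra_simps)
    moreover have "cos t * cos t = 1 - sin t * sin t"
      using cos_squared_eq[of t] unfolding power2_eq_square .
    ultimately have "(1 - sin t) * (1 + sin t) \<le> cos t * q t"
      by (simp only:)
    then have "(1 - sin t) / q t \<le> cos t / (1 + sin t)"
      using trig[OF t] q_pos[of t] by (simp add: divide_simps)
    then show ?thesis by (simp add: diff_divide_distrib)
  qed
  have "ellK r \<le> G (pi/2) - G 0"
    by (rule has_integral_le[OF int upper le])
  also have "\<dots> = ln 2 + (1 / r) * ln ((1 + r) / sqrt (1 - r\<^sup>2))"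
  proof -
    have "ln ((1 + r) / sqrt (1 - r\<^sup>2)) = ln (1 + r) - ln (sqrt (1 - r\<^sup>2))"
      using assms r2 by (intro ln_divide_pos) auto
    moreover have "G (pi/2) = ln 2 - (1 / r) * ln (sqrt (1 - r\<^sup>2))" "G 0 = - (1 / r) * ln (1 + r)"
      by (simp_all add: G_def q_def add.commute)
    ultimately show ?thesis by (simp only: right_diff_distrib)
  qed
  finally show ?thesis .
qed

lemma ellK_bound_limit:
  "((\<lambda>x::real. sqrt (1 - x) * exp (ln 2 + (1 / sqrt x) * ln ((1 + sqrt x) / sqrt (1 - x)))) \<longlongrightarrow> 4) (at_left 1)"
proof -
  have "((\<lambda>x::real. sqrt (1 - x) * exp (ln 2 + (1 / sqrt x) * ln ((1 + sqrt x) / sqrt (1 - x)))) \<longlongrightarrow> exp (2 * ln 2)) (at_left 1)"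
    by real_asymp
  also have "exp (2 * ln 2) = (4 :: real)"
    by (subst exp_double) simp
  finally show ?thesis .
qed

text \<open>
  An Abelian argument: if the ratio reached 4, all coefficients beyond the next one would be at least \<open>\<rho> W k\<close> for
  some \<open>\<rho> > 4\<close>, so \<open>exp (ellK (sqrt x))\<close> would dominate \<open>\<rho> / sqrt (1 - x)\<close> up to a constant, against the limit
  \<open>ellK_bound_limit\<close>. Strictness comes from passing to the next index.
\<close>
lemma exp_coeff_ratio_less:
  assumes "n \<ge> 1"
  shows "exp (pi / 2) * (exp_coeff n / W_coeff n) < 4"
proof (rule ccontr)
  assume "\<not> ?thesis"
  then have ge: "exp (pi / 2) * (exp_coeff n / W_coeff n) \<ge> 4" by simp
  define \<rho> where "\<rho> = exp (pi / 2) * (exp_coeff (Suc n) / W_coeff (Suc n))"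
  have "\<rho> > exp (pi / 2) * (exp_coeff n / W_coeff n)"
    unfolding \<rho>_def by (intro mult_strict_left_mono exp_coeff_ratio_increasing assms) simp
  with ge have \<rho>: "\<rho> > 4" by simp
  have tail: "\<rho> * W_coeff k \<le> exp (pi / 2) * exp_coeff k" if "k > n" for k
  proof -
    have "exp_coeff (Suc n) / W_coeff (Suc n) \<le> exp_coeff k / W_coeff k"
      using exp_coeff_ratio_strict_mono[of "Suc n" k] that by (cases "k = Suc n") auto
    then show ?thesis by (simp add: \<rho>_def field_simps)
  qed
  define C where "C = \<rho> * (\<Sum>k\<le>n. W_coeff k)"
  have lower: "\<rho> - C * sqrt (1 - x) \<le> sqrt (1 - x) * exp (ellK (sqrt x))" if x: "0 < x" "x < 1" for x
  proof -
    have W: "(\<lambda>k. \<rho> * (W_coeff k * x ^ k) - (if k \<in> {..n} then \<rho> * (W_coeff k * x ^ k) else 0))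
        sums (\<rho> * (1 / sqrt (1 - x)) - (\<Sum>k\<in>{..n}. \<rho> * (W_coeff k * x ^ k)))"
      using x by (intro sums_diff sums_mult W_coeff_sums sums_If_finite_set) auto
    have le: "\<rho> * (W_coeff k * x ^ k) - (if k \<in> {..n} then \<rho> * (W_coeff k * x ^ k) else 0)
        \<le> exp (pi / 2) * exp_coeff k * x ^ k" for k
      using tail[of k] x mult_right_mono[OF tail[of k], of "x ^ k"]
      by (auto simp: mult_ac less_imp_le)
    have "\<rho> * (1 / sqrt (1 - x)) - (\<Sum>k\<in>{..n}. \<rho> * (W_coeff k * x ^ k)) \<le> exp (ellK (sqrt x))"
      by (rule sums_le[OF le W scaled_exp_coeff_sums[OF x]])
    moreover have "(\<Sum>k\<in>{..n}. \<rho> * (W_coeff k * x ^ k)) \<le> C"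
      unfolding C_def sum_distrib_left using \<rho> x
      by (intro sum_mono mult_left_mono) (auto simp: mult_left_le power_le_one less_imp_le)
    ultimately have "\<rho> / sqrt (1 - x) - C \<le> exp (ellK (sqrt x))" by simp
    then have "sqrt (1 - x) * (\<rho> / sqrt (1 - x) - C) \<le> sqrt (1 - x) * exp (ellK (sqrt x))"
      using x by (intro mult_left_mono) auto
    then show ?thesis using x by (simp add: right_diff_distrib mult.commute)
  qed
  have "\<rho> \<le> 4"
  proof (rule tendsto_le[OF _ ellK_bound_limit])
    have "((\<lambda>x. \<rho> - C * sqrt (1 - x)) \<longlongrightarrow> \<rho> - C * sqrt (1 - 1)) (at_left 1)"
      by (intro tendsto_intros)
    then show "((\<lambda>x. \<rho> - C * sqrt (1 - x)) \<longlongrightarrow> \<rho>) (at_left 1)" by simp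
    have "\<rho> - C * sqrt (1 - x) \<le> sqrt (1 - x) * exp (ln 2 + (1 / sqrt x) * ln ((1 + sqrt x) / sqrt (1 - x)))"
      if x: "0 < x" "x < 1" for x
    proof -
      have "ellK (sqrt x) \<le> ln 2 + (1 / sqrt x) * ln ((1 + sqrt x) / sqrt (1 - x))"
        using ellK_le[of "sqrt x"] x by simp
      then have "sqrt (1 - x) * exp (ellK (sqrt x))
          \<le> sqrt (1 - x) * exp (ln 2 + (1 / sqrt x) * ln ((1 + sqrt x) / sqrt (1 - x)))"
        using x by (intro mult_left_mono) auto
      with lower[OF x] show ?thesis by linarith
    qed
    then show "eventually (\<lambda>x. \<rho> - C * sqrt (1 - x)
        \<le> sqrt (1 - x) * exp (ln 2 + (1 / sqrt x) * ln ((1 + sqrt x) / sqrt (1 - x)))) (at_left 1)"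
      unfolding eventually_at_left_field by (intro exI[of _ 0]) auto
  qed simp
  with \<rho> show False by simp
qed


section \<open>Signs of the coefficients\<close>

lemma exp_coeff_2: "exp_coeff 2 = pi * (pi + 9) / 128"
proof -
  have B1: "exp_coeff (Suc 0) = pi / 8"
    using exp_coeff_step[of 0] by (simp add: step_conv_def ell_step_0)
  have "2 * exp_coeff (Suc (Suc 0)) = pi / 8 + (pi / 8 * (pi / 8) + pi / 64)"
    using exp_coeff_step[of "Suc 0"] by (simp add: step_conv_def B1 ell_step_0 ell_step_Suc)
  then show ?thesis by (simp add: numeral_2_eq_2 algebra_simps)
qed

lemma W_coeff_2: "W_coeff 2 = 3 / 8"
  by (simp add: W_coeff_Suc numeral_eq_Suc)

lemma exp_coeff_ratio_2:
  "exp (pi / 2) * (exp_coeff 2 / W_coeff 2) = pi * (pi + 9) * exp (pi / 2) / 48"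
proof -
  have "e * (P / 128 / (3 / 8)) = P * e / 48" for e P :: real by simp
  then show ?thesis unfolding exp_coeff_2 W_coeff_2 .
qed

lemma c_coeff_pos:
  assumes "p \<le> pi * (pi + 9) * exp (pi / 2) / 48" "n \<ge> 3"
  shows "c_coeff p n > 0"
proof -
  have "p \<le> exp (pi / 2) * (exp_coeff 2 / W_coeff 2)"
    using assms(1) by (simp only: exp_coeff_ratio_2)
  also have "\<dots> < exp (pi / 2) * (exp_coeff n / W_coeff n)"
    using assms(2) by (intro mult_strict_left_mono exp_coeff_ratio_strict_mono) auto
  finally have "p * W_coeff n < exp (pi / 2) * (exp_coeff n / W_coeff n) * W_coeff n"
    by (rule mult_strict_right_mono) simp
  then show ?thesis by (simp add: c_coeff_def b_coeff_eq less_imp_neq[OF W_coeff_pos, symmetric])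
qed

lemma c_coeff_nonneg:
  assumes "p \<le> pi * (pi + 9) * exp (pi / 2) / 48" "n \<ge> 2"
  shows "c_coeff p n \<ge> 0"
proof (cases "n = 2")
  case True
  have "p \<le> exp (pi / 2) * (exp_coeff 2 / W_coeff 2)"
    using assms(1) by (simp only: exp_coeff_ratio_2)
  then have "p * W_coeff 2 \<le> exp (pi / 2) * (exp_coeff 2 / W_coeff 2) * W_coeff 2"
    by (rule mult_right_mono) (simp add: less_imp_le)
  then show ?thesis
    using True by (simp add: c_coeff_def b_coeff_eq less_imp_neq[OF W_coeff_pos, symmetric])
next
  case False
  then show ?thesis using c_coeff_pos[OF assms(1), of n] assms(2) by simp
qed

lemma c_coeff_neg:
  assumes "p \<ge> 4" "n \<ge> 1"
  shows "c_coeff p n < 0"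
proof -
  have "exp (pi / 2) * (exp_coeff n / W_coeff n) < p"
    using exp_coeff_ratio_less[OF assms(2)] assms(1) by (rule less_le_trans)
  then have "exp (pi / 2) * (exp_coeff n / W_coeff n) * W_coeff n < p * W_coeff n"
    by (rule mult_strict_right_mono) simp
  then show ?thesis by (simp add: c_coeff_def b_coeff_eq less_imp_neq[OF W_coeff_pos, symmetric])
qed

section \<open>Summing the remainder series\<close>

text \<open>
  The identity behind convexity of powers: raising the exponent multiplies by the midpoint and adds
  a term that is nonnegative because \<open>x - y\<close> and \<open>x ^ n - y ^ n\<close> have the same sign.
\<close>
lemma midpoint_power_step:
  fixes x y :: real
  shows "x ^ Suc n + y ^ Suc n = (x + y) / 2 * (x ^ n + y ^ n) + (x - y) * (x ^ n - y ^ n) / 2"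
proof -
  have "x * a + y * b = (x + y) / 2 * (a + b) + (x - y) * (a - b) / 2" for a b
    by (simp add: field_simps)
  then show ?thesis by (simp only: power_Suc)
qed

lemma midpoint_power_le:
  fixes x y :: real
  assumes "0 < x" "0 < y"
  shows "2 * ((x + y) / 2) ^ n \<le> x ^ n + y ^ n"
proof (induction n)
  case (Suc n)
  have "0 \<le> (x - y) * (x ^ n - y ^ n)"
  proof (cases "x \<le> y")
    case True
    then show ?thesis using assms by (intro mult_nonpos_nonpos) (auto intro: power_mono)
  next
    case False
    then show ?thesis using assms by (intro mult_nonneg_nonneg) (auto intro: power_mono)
  qed
  moreover have "(x + y) / 2 * (2 * ((x + y) / 2) ^ n) \<le> (x + y) / 2 * (x ^ n + y ^ n)"
    using assms by (intro mult_left_mono Suc) auto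
  moreover have "2 * ((x + y) / 2) ^ Suc n = (x + y) / 2 * (2 * ((x + y) / 2) ^ n)"
    by simp
  ultimately show ?case unfolding midpoint_power_step[of x n y] by linarith
qed simp

lemma midpoint_power_less:
  fixes x y :: real
  assumes "0 < x" "0 < y" "x \<noteq> y" "n \<ge> 2"
  shows "2 * ((x + y) / 2) ^ n < x ^ n + y ^ n"
proof -
  obtain k where k: "n = Suc k" "k \<ge> 1" using assms(4) by (cases n) auto
  have "0 < (x - y) * (x ^ k - y ^ k)"
  proof (cases "x < y")
    case True
    then show ?thesis using assms k by (intro mult_neg_neg) (auto intro!: power_strict_mono)
  next
    case False
    then show ?thesis using assms k by (intro mult_pos_pos) (auto intro!: power_strict_mono)
  qed
  moreover have "(x + y) / 2 * (2 * ((x + y) / 2) ^ k) \<le> (x + y) / 2 * (x ^ k + y ^ k)"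
    using assms by (intro mult_left_mono midpoint_power_le) auto
  moreover have "2 * ((x + y) / 2) ^ Suc k = (x + y) / 2 * (2 * ((x + y) / 2) ^ k)"
    by simp
  ultimately show ?thesis unfolding k(1) midpoint_power_step[of x k y] by linarith
qed

lemma add_power_less:
  fixes x y :: real
  assumes "0 < x" "0 < y" "n \<ge> 2"
  shows "x ^ n + y ^ n < (x + y) ^ n"
  using assms(3)
proof (induction n rule: dec_induct)
  case base
  show ?case using assms by (simp add: power2_sum)
next
  case (step n)
  have "x ^ Suc n + y ^ Suc n < x ^ Suc n + y ^ Suc n + (x * y ^ n + y * x ^ n)"
    using assms by (intro less_add_same_cancel1[THEN iffD2] add_pos_pos mult_pos_pos zero_less_power)
  also have "\<dots> = (x + y) * (x ^ n + y ^ n)"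
    by (simp add: algebra_simps)
  also have "\<dots> < (x + y) * (x + y) ^ n"
    using assms step by (intro mult_strict_left_mono) auto
  finally show ?case by simp
qed

lemma c_coeff_sums:
  assumes "0 < x" "x < 1"
  shows "(\<lambda>n. c_coeff p n * x ^ n) sums (exp (ellK (sqrt x)) - p * (1 / sqrt (1 - x)))"
proof -
  have "(\<lambda>n. exp (pi / 2) * exp_coeff n * x ^ n - p * (W_coeff n * x ^ n))
      sums (exp (ellK (sqrt x)) - p * (1 / sqrt (1 - x)))"
    using assms by (intro sums_diff sums_mult scaled_exp_coeff_sums W_coeff_sums) auto
  then show ?thesis by (simp add: c_coeff_def b_coeff_eq left_diff_distrib mult.assoc)
qed

text \<open>
  The finite sum in \<open>lower_bd\<close> consists of exactly the first \<open>m + 1\<close> terms of the series of the difference.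
\<close>
lemma lower_bd_remainder_sums:
  assumes "0 < x" "x < 1" "0 < y" "y < 1"
  shows "(\<lambda>n. c_coeff p (n + Suc m) * (x ^ (n + Suc m) + y ^ (n + Suc m) - 2 * ((x + y) / 2) ^ (n + Suc m)))
    sums (exp (ellK (sqrt x)) + exp (ellK (sqrt y)) - lower_bd m p x y)"
proof -
  let ?g = "\<lambda>x. exp (ellK (sqrt x)) - p * (1 / sqrt (1 - x))"
  have "(\<lambda>n. c_coeff p n * x ^ n + c_coeff p n * y ^ n - 2 * (c_coeff p n * ((x + y) / 2) ^ n))
      sums (?g x + ?g y - 2 * ?g ((x + y) / 2))"
    using assms by (intro sums_diff sums_add sums_mult c_coeff_sums) auto
  then have "(\<lambda>n. c_coeff p n * (x ^ n + y ^ n - 2 * ((x + y) / 2) ^ n))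
      sums (?g x + ?g y - 2 * ?g ((x + y) / 2))"
    by (simp add: algebra_simps)
  from sums_split_initial_segment[OF this, of "Suc m"] show ?thesis
    by (rule back_subst[of "\<lambda>s. _ sums s"])
       (simp add: lower_bd_def lessThan_Suc_atMost atMost_atLeast0 algebra_simps)
qed

lemma upper_bd_remainder_sums:
  assumes "0 < x" "0 < y" "x + y < 1"
  shows "(\<lambda>n. c_coeff p (n + Suc m) * (x ^ (n + Suc m) + y ^ (n + Suc m) - (x + y) ^ (n + Suc m)))
    sums (exp (ellK (sqrt x)) + exp (ellK (sqrt y)) - upper_bd m p x y)"
proof -
  let ?g = "\<lambda>x. exp (ellK (sqrt x)) - p * (1 / sqrt (1 - x))"
  have "(\<lambda>n. c_coeff p n * x ^ n + c_coeff p n * y ^ n - c_coeff p n * (x + y) ^ n)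
      sums (?g x + ?g y - ?g (x + y))"
    using assms by (intro sums_diff sums_add c_coeff_sums) auto
  then have "(\<lambda>n. c_coeff p n * (x ^ n + y ^ n - (x + y) ^ n)) sums (?g x + ?g y - ?g (x + y))"
    by (simp add: algebra_simps)
  from sums_split_initial_segment[OF this, of "Suc m"] show ?thesis
    by (rule back_subst[of "\<lambda>s. _ sums s"])
       (simp add: upper_bd_def lessThan_Suc_atMost atMost_atLeast0 algebra_simps)
qed

lemma sums_pos:
  fixes f :: "nat \<Rightarrow> real"
  assumes "f sums s" "\<And>n. 0 \<le> f n" "0 < f i"
  shows "0 < s"
proof -
  have "0 < suminf f"
    by (rule suminf_pos2[OF sums_summable[OF assms(1)] assms(2,3)])
  then show ?thesis using sums_unique[OF assms(1)] by simp
qed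

lemma power_combination_signs:
  fixes c :: "nat \<Rightarrow> real" and x y :: real
  assumes xy: "0 < x" "0 < y" and n: "n \<ge> 1" and c: "n \<ge> 2 \<Longrightarrow> 0 \<le> c n"
  shows "0 \<le> c n * (x ^ n + y ^ n - 2 * ((x + y) / 2) ^ n)"
    and "c n * (x ^ n + y ^ n - (x + y) ^ n) \<le> 0"
proof -
  consider "n = 1" | "n \<ge> 2" using n by linarith
  then have "0 \<le> c n * (x ^ n + y ^ n - 2 * ((x + y) / 2) ^ n) \<and> c n * (x ^ n + y ^ n - (x + y) ^ n) \<le> 0"
  proof cases
    case 2
    show ?thesis
      using midpoint_power_le[OF xy, of n] add_power_less[OF xy 2] c[OF 2]
      by (intro conjI mult_nonneg_nonneg mult_nonneg_nonpos) linarith+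
  qed (simp add: field_simps)
  then show "0 \<le> c n * (x ^ n + y ^ n - 2 * ((x + y) / 2) ^ n)"
    and "c n * (x ^ n + y ^ n - (x + y) ^ n) \<le> 0" by auto
qed

text \<open>
  Strictness needs one strict term in the tail; the one with index \<open>m + 3\<close> serves, since \<open>c\<close> may
  vanish at 2. The lemma is stated for arbitrary coefficients so that it also covers \<open>p \<ge> 4\<close>,
  with \<open>c\<close> the negated coefficients.
\<close>
lemma remainder_signs:
  fixes c :: "nat \<Rightarrow> real" and x y :: real
  assumes xy: "0 < x" "0 < y"
    and c: "\<And>n. n \<ge> 2 \<Longrightarrow> 0 \<le> c n" "\<And>n. n \<ge> 3 \<Longrightarrow> 0 < c n"
    and L: "(\<lambda>n. c (n + Suc m) * (x ^ (n + Suc m) + y ^ (n + Suc m) - 2 * ((x + y) / 2) ^ (n + Suc m))) sums L"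
    and U: "(\<lambda>n. c (n + Suc m) * (x ^ (n + Suc m) + y ^ (n + Suc m) - (x + y) ^ (n + Suc m))) sums U"
  shows "0 \<le> L" "x \<noteq> y \<Longrightarrow> 0 < L" "U < 0"
proof -
  show "0 \<le> L"
    by (rule sums_le[OF _ sums_zero L]) (intro power_combination_signs xy c, simp_all)
  show "0 < L" if "x \<noteq> y"
  proof (rule sums_pos[OF L])
    show "0 < c (2 + Suc m) * (x ^ (2 + Suc m) + y ^ (2 + Suc m) - 2 * ((x + y) / 2) ^ (2 + Suc m))"
      using midpoint_power_less[OF xy that, of "2 + Suc m"] c(2)[of "2 + Suc m"]
      by (intro mult_pos_pos) auto
  qed (intro power_combination_signs xy c, simp_all)
  have "0 < - U"
  proof (rule sums_pos[OF sums_minus[OF U]])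
    show "0 < - (c (2 + Suc m) * (x ^ (2 + Suc m) + y ^ (2 + Suc m) - (x + y) ^ (2 + Suc m)))"
      using add_power_less[OF xy, of "2 + Suc m"] c(2)[of "2 + Suc m"]
      by (intro neg_0_less_iff_less[THEN iffD2] mult_pos_neg) auto
    show "0 \<le> - (c (n + Suc m) * (x ^ (n + Suc m) + y ^ (n + Suc m) - (x + y) ^ (n + Suc m)))" for n
      using power_combination_signs(2)[OF xy, of "n + Suc m" c] c(1) by simp
  qed
  then show "U < 0" by simp
qed

(* On the diagonal x = y the midpoint bound is an identity, so strictness of the first
   inequality is claimed for x \<noteq> y only. *)
theorem proposition3:
  fixes m :: nat and p :: real
  shows
    "(p \<le> pi * (pi + 9) * exp (pi / 2) / 48 \<longrightarrow>
       (\<forall>x y :: real. x \<in> {0<..<1} \<and> y \<in> {0<..<1} \<and> x + y \<in> {0<..<1} \<longrightarrow>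
          lower_bd m p x y \<le> exp (ellK (sqrt x)) + exp (ellK (sqrt y)) \<and>
          (x \<noteq> y \<longrightarrow> lower_bd m p x y < exp (ellK (sqrt x)) + exp (ellK (sqrt y))) \<and>
          exp (ellK (sqrt x)) + exp (ellK (sqrt y)) < upper_bd m p x y)) \<and>
     (p \<ge> 4 \<longrightarrow>
       (\<forall>x y :: real. x \<in> {0<..<1} \<and> y \<in> {0<..<1} \<and> x + y \<in> {0<..<1} \<longrightarrow>
          lower_bd m p x y \<ge> exp (ellK (sqrt x)) + exp (ellK (sqrt y)) \<and>
          (x \<noteq> y \<longrightarrow> lower_bd m p x y > exp (ellK (sqrt x)) + exp (ellK (sqrt y))) \<and>
          exp (ellK (sqrt x)) + exp (ellK (sqrt y)) > upper_bd m p x y))"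
proof -
  let ?S = "\<lambda>x y. exp (ellK (sqrt x)) + exp (ellK (sqrt y))"
  have le: "lower_bd m p x y \<le> ?S x y \<and> (x \<noteq> y \<longrightarrow> lower_bd m p x y < ?S x y) \<and> ?S x y < upper_bd m p x y"
    if p: "p \<le> pi * (pi + 9) * exp (pi / 2) / 48" and xy: "0 < x" "0 < y" "x + y < 1" for x y
  proof -
    have L: "0 < x" "x < 1" "0 < y" "y < 1" using xy by auto
    note signs = remainder_signs[OF xy(1,2) c_coeff_nonneg[OF p] c_coeff_pos[OF p]
        lower_bd_remainder_sums[OF L] upper_bd_remainder_sums[OF xy]]
    show ?thesis using signs by auto
  qed
  have ge: "lower_bd m p x y \<ge> ?S x y \<and> (x \<noteq> y \<longrightarrow> lower_bd m p x y > ?S x y) \<and> ?S x y > upper_bd m p x y"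
    if p: "p \<ge> 4" and xy: "0 < x" "0 < y" "x + y < 1" for x y
  proof -
    have L: "0 < x" "x < 1" "0 < y" "y < 1" using xy by auto
    have c: "0 < - c_coeff p n" if "n \<ge> 2" for n
      using c_coeff_neg[OF p, of n] that by simp
    have L': "(\<lambda>n. - c_coeff p (n + Suc m) * (x ^ (n + Suc m) + y ^ (n + Suc m) - 2 * ((x + y) / 2) ^ (n + Suc m)))
        sums - (?S x y - lower_bd m p x y)"
      using sums_minus[OF lower_bd_remainder_sums[OF L]] by (simp only: mult_minus_left)
    have U': "(\<lambda>n. - c_coeff p (n + Suc m) * (x ^ (n + Suc m) + y ^ (n + Suc m) - (x + y) ^ (n + Suc m)))
        sums - (?S x y - upper_bd m p x y)"
      using sums_minus[OF upper_bd_remainder_sums[OF xy]] by (simp only: mult_minus_left)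
    note signs = remainder_signs[of x y "\<lambda>n. - c_coeff p n", OF xy(1,2) less_imp_le[OF c] c L' U']
    show ?thesis using signs by auto
  qed
  show ?thesis using le ge by auto
qed

end
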